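(* Let $\varphi$ be an analytic function on the open unit disk $\mathbb{D}$ with $\varphi(\mathbb{D})\subseteq\mathbb{D}$. Suppose that $X$ is a set of analytic functions on $\mathbb{D}$ such that (i) $f\circ\varphi\in X$ whenever $f\in X$; (ii) $X$ contains a univalent function; (iii) $X$ contains a nonconstant function that is analytic on a neighborhood of the closed disk $\overline{\mathbb{D}}$; and (iv) there is a dense subset $S$ of the unit circle $\partial\mathbb{D}$ such that for each point in $S$ there is a function in $X$ that does not extend analytically to a neighborhood of that point. If the composition operator $C_\varphi : X\to X$, $C_\varphi f = f\circ\varphi$, is invertible on $X$, then $\varphi$ is an automorphism of $\mathbb{D}$.
   Context: $\mathbb{D}=\{z\in\mathbb{C}:|z|<1\}$. The set $X$ is only a set of analytic functions on $\mathbb{D}$; it is not assumed to have any linear or norm structure. "Invertible on $X$" means that the map $C_\varphi : X\to X$ is a bijection. "Univalent" means analytic and injective on $\mathbb{D}$. In (iii), the function is an element of $X$ (hence defined on $\mathbb{D}$) that has an analytic extension to an open set containing $\overline{\mathbb{D}}$. A function $f$ analytic on $\mathbb{D}$ extends analytically to a neighborhood of $\zeta\in\partial\mathbb{D}$ if there are an open disk $U$ centered at $\zeta$ and an analytic function on $\mathbb{D}\cup U$ that agrees with $f$ on $\mathbb{D}$. An automorphism of $\mathbb{D}$ is an analytic bijection of $\mathbb{D}$ onto $\mathbb{D}$. *)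

theory Defs
  imports "HOL-Complex_Analysis.Complex_Analysis" "HOL-Library.FuncSet"
begin

abbreviation unit_disc :: "complex set"  ("\<D>")
  where "\<D> \<equiv> ball 0 1"

text \<open>
  A function defined on the disc only is represented by its extensional representative (constantly
  \<^term>\<open>undefined\<close> off \<open>\<D>\<close>), so that two elements of \<open>analytic_funs\<close> are equal
  iff they agree on \<open>\<D>\<close>. Bijectivity of an operator on a set of such functions
  then does not depend on junk values outside the disc.
\<close>

definition analytic_funs :: "(complex \<Rightarrow> complex) set"
  where "analytic_funs = {f \<in> extensional \<D>. f holomorphic_on \<D>}"

definition comp_operator :: "(complex \<Rightarrow> complex) \<Rightarrow> (complex \<Rightarrow> complex) \<Rightarrow> (complex \<Rightarrow> complex)"
  where "comp_operator \<phi> f = restrict (f \<circ> \<phi>) \<D>"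

definition univalent :: "(complex \<Rightarrow> complex) \<Rightarrow> bool"
  where "univalent f \<longleftrightarrow> f holomorphic_on \<D> \<and> inj_on f \<D>"

definition analytic_near_closed_disc :: "(complex \<Rightarrow> complex) \<Rightarrow> bool"
  where "analytic_near_closed_disc f \<longleftrightarrow>
    (\<exists>U g. open U \<and> cball 0 1 \<subseteq> U \<and> g holomorphic_on U \<and> (\<forall>z\<in>\<D>. g z = f z))"

definition extends_analytically_near :: "(complex \<Rightarrow> complex) \<Rightarrow> complex \<Rightarrow> bool"
  where "extends_analytically_near f \<zeta> \<longleftrightarrow>
    (\<exists>r>0. \<exists>g. g holomorphic_on (\<D> \<union> ball \<zeta> r) \<and> (\<forall>z\<in>\<D>. g z = f z))"

definition disc_automorphism :: "(complex \<Rightarrow> complex) \<Rightarrow> bool"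
  where "disc_automorphism \<phi> \<longleftrightarrow> \<phi> holomorphic_on \<D> \<and> bij_betw \<phi> \<D> \<D>"

end

theory Submission
  imports Defs
begin

text \<open>
  Surjectivity of \<^term>\<open>comp_operator \<phi>\<close> means that every member of \<open>X\<close> factors through \<open>\<phi>\<close> on the disc.
  Factoring a univalent member shows that \<open>\<phi>\<close> is injective. Suppose that \<open>\<phi>\<close> misses a point of
  the disc, and factor the member \<open>h\<close> that is analytic across the circle as \<open>h = g \<circ> \<phi>\<close>.

  The contradiction comes from a boundary point \<open>w\<close> of \<open>\<phi> ` \<D>\<close> that lies inside the disc. Preimages of
  points tending to \<open>w\<close> must accumulate at some \<open>\<zeta>\<close> on the circle. If \<open>deriv g w \<noteq> 0\<close>, the
  equation \<open>h = g \<circ> \<phi>\<close> can be solved for \<open>\<phi>\<close>: with the branch of the inverse of \<open>g\<close> at \<open>w\<close>, the function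
  \<open>g\<^sup>-\<^sup>1 \<circ> h\<close> is analytic near \<open>\<zeta>\<close>, and it continues \<open>\<phi>\<close> across the circle with values inside the
  disc (\<open>analytic_extension_by_local_inverse\<close>). But then every \<open>f = q \<circ> \<phi>\<close> in \<open>X\<close> extends across the circle at all
  points near \<open>\<zeta>\<close>, which density of the singular points forbids.

  It remains to find a \<open>w\<close> with \<open>deriv g w \<noteq> 0\<close>. The zeros of \<open>deriv g\<close> are isolated, so it is enough
  that the boundary of \<open>\<phi> ` \<D>\<close> inside the disc has no isolated points. At an isolated one, the inverse
  of \<open>\<phi>\<close> would have a removable singularity, and its value there would be a preimage
  (\<open>univalent_image_no_isolated_gap\<close>).
\<close>

section \<open>The boundary of a univalent image\<close>

text \<open>
  The inverse of \<open>\<phi>\<close> is bounded near \<open>w\<close>, so it extends holomorphically to \<open>w\<close>. By the open mapping theorem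
  the extended inverse still takes values in the interior of the closure of \<open>\<Omega>\<close>, which is \<open>\<Omega>\<close>
  by convexity; continuity then makes its value at \<open>w\<close> a preimage of \<open>w\<close>.
\<close>

lemma univalent_image_no_isolated_gap:
  fixes \<phi> :: "complex \<Rightarrow> complex"
  assumes hol: "\<phi> holomorphic_on \<Omega>" and inj: "inj_on \<phi> \<Omega>"
    and \<Omega>: "open \<Omega>" "convex \<Omega>" "bounded \<Omega>"
    and r: "r > 0" "ball w r - {w} \<subseteq> \<phi> ` \<Omega>"
  shows "w \<in> \<phi> ` \<Omega>"
proof -
  let ?P = "ball w r - {w}"
  obtain \<psi> where \<psi>: "\<psi> holomorphic_on (\<phi> ` \<Omega>)" "\<And>z. z \<in> \<Omega> \<Longrightarrow> \<psi> (\<phi> z) = z"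
    using holomorphic_has_inverse[OF hol \<Omega>(1) inj] by metis
  have \<psi>P: "\<psi> u \<in> \<Omega>" "\<phi> (\<psi> u) = u" if "u \<in> ?P" for u
    using \<psi>(2) r(2) that by force+
  obtain B where B: "\<And>z. z \<in> \<Omega> \<Longrightarrow> norm z \<le> B"
    using \<Omega>(3) by (auto simp: bounded_iff)
  have "\<psi> \<in> O[at w](\<lambda>_. 1)"
    by (intro landau_o.bigI[of "max 1 B"])
       (use r(1) \<psi>P(1) B in \<open>force simp: eventually_at dist_commute intro!: exI[of _ r]\<close>)+
  moreover have "\<psi> holomorphic_on ?P"
    using \<psi>(1) r(2) holomorphic_on_subset by blast
  ultimately obtain \<Psi> where \<Psi>: "\<Psi> holomorphic_on ball w r" "\<And>u. u \<in> ?P \<Longrightarrow> \<Psi> u = \<psi> u"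
    using holomorphic_on_extend[of \<psi> "ball w r" w] r(1) by (auto simp: interior_open)
  have lim: "(\<Psi> \<longlongrightarrow> \<Psi> w) (at w)"
    using \<Psi>(1) r(1) by (metis centre_in_ball continuous_on_eq_continuous_at holomorphic_on_imp_continuous_on
        isCont_def open_ball)
  have evP: "\<forall>\<^sub>F u in at w. u \<in> ?P"
    using r(1) by (auto simp: eventually_at dist_commute intro!: exI[of _ r])
  have "\<Psi> w \<in> closure \<Omega>"
    by (rule Lim_in_closed_set[OF closed_closure _ _ lim])
       (use evP \<Psi>(2) \<psi>P(1) closure_subset[of \<Omega>] in \<open>force elim!: eventually_mono\<close>)+
  moreover have "\<Psi> u \<in> closure \<Omega>" if "u \<in> ?P" for u
    using \<Psi>(2)[OF that] \<psi>P(1)[OF that] closure_subset[of \<Omega>] by auto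
  ultimately have im: "\<Psi> ` ball w r \<subseteq> closure \<Omega>" by blast
  have "\<not> \<Psi> constant_on ball w r"
  proof
    assume "\<Psi> constant_on ball w r"
    then obtain c where c: "\<And>u. u \<in> ball w r \<Longrightarrow> \<Psi> u = c"
      by (auto simp: constant_on_def)
    have "u = \<phi> c" if "u \<in> ?P" for u
      using c[of u] \<Psi>(2)[OF that] \<psi>P(2)[OF that] that by auto
    then have "?P \<subseteq> {\<phi> c}" by blast
    then have "ball w r \<subseteq> {w, \<phi> c}" by blast
    then have "finite (ball w r)" using finite_subset by blast
    then show False using uncountable_ball[of r w] r(1) countable_finite by blast
  qed
  then have "open (\<Psi> ` ball w r)"
    using open_mapping_thm[OF \<Psi>(1)] by auto
  then have "\<Psi> ` ball w r \<subseteq> interior (closure \<Omega>)"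
    using im interior_maximal by blast
  then have \<Psi>w: "\<Psi> w \<in> \<Omega>"
    using convex_interior_closure[OF \<Omega>(2)] \<Omega>(1) r(1) by (auto simp: interior_open)
  have "((\<lambda>u. \<phi> (\<Psi> u)) \<longlongrightarrow> \<phi> (\<Psi> w)) (at w)"
    using hol \<Omega>(1) \<Psi>w lim by (metis continuous_on_eq_continuous_at holomorphic_on_imp_continuous_on isCont_tendsto_compose)
  moreover have "((\<lambda>u. \<phi> (\<Psi> u)) \<longlongrightarrow> w) (at w)"
    by (rule Lim_transform_eventually[OF tendsto_ident_at])
       (use evP \<Psi>(2) \<psi>P(2) in \<open>auto elim!: eventually_mono\<close>)
  ultimately have "\<phi> (\<Psi> w) = w"
    using tendsto_unique trivial_limit_at by blast
  then show ?thesis using \<Psi>w by force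
qed

text \<open>
  The critical points of \<open>g\<close> are isolated, so if one of them is a frontier point, any other frontier point
  close to it is noncritical. Such a point exists: a punctured ball around the first point is connected and
  meets the image without lying inside it, hence meets the frontier again.
\<close>

lemma univalent_image_frontier_point_regular:
  fixes \<phi> g :: "complex \<Rightarrow> complex"
  assumes hol: "\<phi> holomorphic_on \<Omega>" and inj: "inj_on \<phi> \<Omega>"
    and \<Omega>: "open \<Omega>" "convex \<Omega>" "bounded \<Omega>" "\<Omega> \<noteq> {}"
    and V: "open V" "connected V" "\<phi> ` \<Omega> \<subset> V"
    and g: "g holomorphic_on V" "\<not> g constant_on V"
  obtains w where "w \<in> V" "w \<in> frontier (\<phi> ` \<Omega>)" "deriv g w \<noteq> 0"
proof -
  let ?W = "\<phi> ` \<Omega>"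
  have "open ?W" by (rule open_mapping_thm3[OF hol \<Omega>(1) inj])
  have "V \<inter> frontier ?W \<noteq> {}"
    using connected_Int_frontier[OF V(2), of ?W] V(3) \<Omega>(4) by blast
  then obtain w0 where w0: "w0 \<in> V" "w0 \<in> frontier ?W" by blast
  show thesis
  proof (cases "deriv g w0 = 0")
    case False
    then show ?thesis using w0 that by blast
  next
    case True
    have dhol: "deriv g holomorphic_on V"
      using g(1) V(1) by (rule holomorphic_deriv)
    obtain b where b: "b \<in> V" "deriv g b \<noteq> 0"
    proof (rule ccontr)
      assume "\<not> thesis"
      then have "\<And>x. x \<in> V \<Longrightarrow> deriv g x = 0" using that by blast
      then have "\<And>x. x \<in> V \<Longrightarrow> (g has_field_derivative 0) (at x)"
        using g(1) V(1) holomorphic_derivI by metis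
      then have "g constant_on V"
        using DERIV_zero_connected_constant_on[OF V(2,1) finite.emptyI] g(1)
        by (simp add: holomorphic_on_imp_continuous_on)
      then show False using g(2) by blast
    qed
    obtain s where s: "s > 0" "ball w0 s \<subseteq> V" "\<And>z. z \<in> ball w0 s - {w0} \<Longrightarrow> deriv g z \<noteq> 0"
      using isolated_zeros[OF dhol V(1,2) w0(1) True b] by metis
    let ?P = "ball w0 s - {w0}"
    have "w0 \<notin> ?W"
      using w0(2) \<open>open ?W\<close> by (simp add: frontier_def interior_open)
    then have "\<not> ?P \<subseteq> ?W"
      using univalent_image_no_isolated_gap[OF hol inj \<Omega>(1-3) s(1)] by blast
    moreover have "?P \<inter> ?W \<noteq> {}"
    proof -
      obtain y where "y \<in> ?W" "dist y w0 < s"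
        using w0(2) s(1) closure_approachable[of w0 ?W] unfolding frontier_def by blast
      then show ?thesis using \<open>w0 \<notin> ?W\<close> by (auto simp: dist_commute)
    qed
    moreover have "connected ?P"
      by (rule connected_open_delete) auto
    ultimately have "?P \<inter> frontier ?W \<noteq> {}"
      using connected_Int_frontier[of ?P ?W] by blast
    then show ?thesis using s that by blast
  qed
qed

section \<open>Continuation across the boundary\<close>

text \<open>
  The continuation is \<open>g\<^sup>-\<^sup>1 \<circ> h\<close>. It agrees with \<open>\<phi>\<close> not only at the points \<open>z n\<close> with \<open>n\<close> large but on a
  neighbourhood of each of them, because \<open>g\<close> is injective near \<open>w\<close>; so the identity theorem applies inside \<open>\<Omega>\<close>,
  although the \<open>z n\<close> accumulate only at \<open>\<zeta>\<close>, which may lie on its boundary.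
  Convexity of \<open>\<Omega>\<close> makes its intersection with a ball connected.
\<close>

lemma analytic_extension_by_local_inverse:
  fixes \<phi> g h :: "complex \<Rightarrow> complex"
  assumes \<phi>: "\<phi> holomorphic_on \<Omega>" "open \<Omega>" "convex \<Omega>"
    and g: "g holomorphic_on V" "open V" "w \<in> V" "deriv g w \<noteq> 0"
    and h: "h holomorphic_on U" "open U" "\<zeta> \<in> U"
    and eq: "\<And>z. z \<in> \<Omega> \<Longrightarrow> z \<in> U \<Longrightarrow> g (\<phi> z) = h z"
    and z: "\<And>n. z n \<in> \<Omega>" "z \<longlonglongrightarrow> \<zeta>" "(\<lambda>n. \<phi> (z n)) \<longlonglongrightarrow> w"
  obtains r \<Phi> where "r > 0" "\<Phi> holomorphic_on ball \<zeta> r" "\<Phi> ` ball \<zeta> r \<subseteq> V"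
    "\<And>u. u \<in> \<Omega> \<inter> ball \<zeta> r \<Longrightarrow> \<Phi> u = \<phi> u"
proof -
  obtain s where s: "s > 0" "ball w s \<subseteq> V" "open (g ` ball w s)" "inj_on g (ball w s)"
    using has_complex_derivative_locally_invertible[OF g(1,3,2,4)] by metis
  let ?B = "ball w s"
  have gB: "g holomorphic_on ?B" using g(1) s(2) holomorphic_on_subset by blast
  obtain k where k: "k holomorphic_on (g ` ?B)" "\<And>u. u \<in> ?B \<Longrightarrow> k (g u) = u"
    using holomorphic_has_inverse[OF gB open_ball s(4)] by metis
  have ev: "\<forall>\<^sub>F n in sequentially. \<phi> (z n) \<in> ?B"
    using topological_tendstoD[OF z(3) open_ball] s(1) by simp
  have contU: "continuous_on U h" and cont\<Omega>: "continuous_on \<Omega> \<phi>" and "isCont g w" "isCont h \<zeta>"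
    using h \<phi>(1) g by (auto intro: holomorphic_on_imp_continuous_on simp: continuous_on_eq_continuous_at 
        dest!: holomorphic_on_imp_continuous_on)
  have "(\<lambda>n. g (\<phi> (z n))) \<longlonglongrightarrow> g w"
    using isCont_tendsto_compose[OF \<open>isCont g w\<close> z(3)] .
  moreover have evU: "\<forall>\<^sub>F n in sequentially. z n \<in> U"
    using topological_tendstoD[OF z(2) h(2,3)] .
  then have "\<forall>\<^sub>F n in sequentially. g (\<phi> (z n)) = h (z n)"
    by eventually_elim (use z(1) eq in auto)
  ultimately have "(\<lambda>n. h (z n)) \<longlonglongrightarrow> g w"
    by (rule Lim_transform_eventually)
  with isCont_tendsto_compose[OF \<open>isCont h \<zeta>\<close> z(2)] have "h \<zeta> = g w"
    using LIMSEQ_unique by blast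
  then have "\<zeta> \<in> U \<inter> h -` (g ` ?B)" using h(3) s(1) by auto
  moreover have "open (U \<inter> h -` (g ` ?B))"
    by (rule continuous_open_preimage[OF contU h(2) s(3)])
  ultimately obtain r where r: "r > 0" "ball \<zeta> r \<subseteq> U \<inter> h -` (g ` ?B)"
    using open_contains_ball by metis
  define \<Phi> where "\<Phi> = k \<circ> h"
  have hol\<Phi>: "\<Phi> holomorphic_on ball \<zeta> r"
    unfolding \<Phi>_def
    by (rule holomorphic_on_compose_gen[OF holomorphic_on_subset[OF h(1)] k(1)]) (use r(2) in auto)
  have im\<Phi>: "\<Phi> u \<in> ?B" if "u \<in> ball \<zeta> r" for u
  proof -
    have "h u \<in> g ` ?B" using r(2) that by blast
    then show ?thesis using k(2) by (auto simp: \<Phi>_def)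
  qed
  have agree: "\<Phi> u = \<phi> u" if "u \<in> \<Omega> \<inter> ball \<zeta> r" "\<phi> u \<in> ?B" for u
    using that k(2)[of "\<phi> u"] eq[of u] r(2) by (auto simp: \<Phi>_def)
  have "\<forall>\<^sub>F n in sequentially. z n \<in> ball \<zeta> r"
    using topological_tendstoD[OF z(2) open_ball] r(1) by simp
  then obtain n where n: "\<phi> (z n) \<in> ?B" "z n \<in> ball \<zeta> r"
    using eventually_happens'[OF _ eventually_conj[OF ev]] by auto
  define N where "N = (\<Omega> \<inter> \<phi> -` ?B) \<inter> ball \<zeta> r"
  have "open N"
    unfolding N_def by (intro open_Int open_ball continuous_open_preimage[OF cont\<Omega> \<phi>(2)])
  moreover have "N \<noteq> {}" using n z(1) unfolding N_def by blast
  moreover have "connected (\<Omega> \<inter> ball \<zeta> r)"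
    by (intro convex_connected convex_Int \<phi>(3) convex_ball)
  moreover have "N \<subseteq> \<Omega> \<inter> ball \<zeta> r" "open (\<Omega> \<inter> ball \<zeta> r)"
    using \<phi>(2) by (auto simp: N_def)
  moreover have "\<Phi> holomorphic_on \<Omega> \<inter> ball \<zeta> r" "\<phi> holomorphic_on \<Omega> \<inter> ball \<zeta> r"
    by (rule holomorphic_on_subset[OF hol\<Phi>] holomorphic_on_subset[OF \<phi>(1)], blast)+
  moreover have "\<And>u. u \<in> N \<Longrightarrow> \<Phi> u = \<phi> u"
    using agree unfolding N_def by blast
  ultimately have "\<Phi> u = \<phi> u" if "u \<in> \<Omega> \<inter> ball \<zeta> r" for u
    using that analytic_continuation_open[of N "\<Omega> \<inter> ball \<zeta> r" \<Phi> \<phi> u] by blast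
  then show thesis
    using that[OF r(1) hol\<Phi>] im\<Phi> s(2) by blast
qed

section \<open>Invertible composition operators\<close>

lemma comp_operator_factorisation:
  assumes "bij_betw (comp_operator \<phi>) X X" "f \<in> X"
  obtains g where "g \<in> X" "\<And>z. z \<in> \<D> \<Longrightarrow> f z = g (\<phi> z)"
proof -
  obtain g where "g \<in> X" "f = comp_operator \<phi> g"
    using assms by (auto simp: bij_betw_def)
  then show thesis using that by (auto simp: comp_operator_def)
qed

theorem theorem2p1:
  fixes \<phi> :: "complex \<Rightarrow> complex" and X :: "(complex \<Rightarrow> complex) set"
  assumes "\<phi> holomorphic_on \<D>" and "\<phi> ` \<D> \<subseteq> \<D>"
    and "X \<subseteq> analytic_funs"
    and "\<forall>f\<in>X. comp_operator \<phi> f \<in> X"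
    and "\<exists>f\<in>X. univalent f"
    and "\<exists>f\<in>X. \<not> f constant_on \<D> \<and> analytic_near_closed_disc f"
    and "\<exists>S. S \<subseteq> sphere 0 1 \<and> sphere 0 1 \<subseteq> closure S \<and>
           (\<forall>\<zeta>\<in>S. \<exists>f\<in>X. \<not> extends_analytically_near f \<zeta>)"
    and "bij_betw (comp_operator \<phi>) X X"
  shows "disc_automorphism \<phi>"
proof -
  note factor = comp_operator_factorisation[OF assms(8)]
  have X_hol: "f holomorphic_on \<D>" if "f \<in> X" for f
    using assms(3) that by (auto simp: analytic_funs_def)
  have inj: "inj_on \<phi> \<D>"
  proof -
    obtain f where f: "f \<in> X" "inj_on f \<D>" using assms(5) by (auto simp: univalent_def)
    obtain g where "\<And>z. z \<in> \<D> \<Longrightarrow> f z = g (\<phi> z)" using factor[OF f(1)] by metis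
    then show ?thesis using f(2) by (metis inj_on_def)
  qed
  have "\<phi> ` \<D> = \<D>"
  proof (rule ccontr)
    assume "\<phi> ` \<D> \<noteq> \<D>"
    then have proper: "\<phi> ` \<D> \<subset> \<D>" using assms(2) by blast
    obtain h0 where h0: "h0 \<in> X" "\<not> h0 constant_on \<D>" "analytic_near_closed_disc h0"
      using assms(6) by blast
    obtain U h where h: "open U" "cball 0 1 \<subseteq> U" "h holomorphic_on U" "\<And>z. z \<in> \<D> \<Longrightarrow> h z = h0 z"
      using h0(3) by (auto simp: analytic_near_closed_disc_def)
    obtain g where g: "g \<in> X" "\<And>z. z \<in> \<D> \<Longrightarrow> h0 z = g (\<phi> z)"
      using factor[OF h0(1)] by metis
    have "\<not> g constant_on \<D>"
    proof
      assume "g constant_on \<D>"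
      then obtain c where "\<And>u. u \<in> \<D> \<Longrightarrow> g u = c" by (auto simp: constant_on_def)
      then have "h0 z = c" if "z \<in> \<D>" for z using g(2) assms(2) that by blast
      then show False using h0(2) by (auto simp: constant_on_def)
    qed
    then obtain w where w: "w \<in> \<D>" "w \<in> frontier (\<phi> ` \<D>)" "deriv g w \<noteq> 0"
      using univalent_image_frontier_point_regular[OF assms(1) inj _ _ _ _ _ _ proper X_hol[OF g(1)]]
      by auto
    have "open (\<phi> ` \<D>)" by (rule open_mapping_thm3[OF assms(1) open_ball inj])
    then have "w \<notin> \<phi> ` \<D>" using w(2) by (simp add: frontier_def interior_open)
    have "w \<in> closure (\<phi> ` \<D>)" using w(2) by (simp add: frontier_def)
    then obtain y where y: "\<And>n. y n \<in> \<phi> ` \<D>" "y \<longlonglongrightarrow> w"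
      by (auto simp: closure_sequential)
    then have "\<forall>n. \<exists>x\<in>\<D>. \<phi> x = y n" by (metis imageE)
    then obtain x where x: "\<And>n. x n \<in> \<D>" "\<And>n. \<phi> (x n) = y n" by metis
    have "\<And>n. x n \<in> cball 0 1" using x(1) ball_subset_cball by blast
    then obtain \<zeta> \<rho> where \<zeta>: "\<zeta> \<in> cball 0 1" "strict_mono \<rho>" "(x \<circ> \<rho>) \<longlonglongrightarrow> \<zeta>"
      using compact_cball[of "0::complex" 1] unfolding compact_def by metis
    have lim: "(\<lambda>n. \<phi> ((x \<circ> \<rho>) n)) \<longlonglongrightarrow> w"
      using LIMSEQ_subseq_LIMSEQ[OF y(2) \<zeta>(2)] x(2) by (simp add: o_def)
    have "\<zeta> \<notin> \<D>"
    proof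
      assume "\<zeta> \<in> \<D>"
      then have "isCont \<phi> \<zeta>"
        using assms(1) by (metis continuous_on_eq_continuous_at holomorphic_on_imp_continuous_on open_ball)
      then have "(\<lambda>n. \<phi> ((x \<circ> \<rho>) n)) \<longlonglongrightarrow> \<phi> \<zeta>"
        using \<zeta>(3) isCont_tendsto_compose by blast
      then have "\<phi> \<zeta> = w" using lim LIMSEQ_unique by blast
      then show False using \<open>\<zeta> \<in> \<D>\<close> \<open>w \<notin> \<phi> ` \<D>\<close> by blast
    qed
    then have "\<zeta> \<in> sphere 0 1" using \<zeta>(1) by auto
    have "\<zeta> \<in> U" "\<And>n. (x \<circ> \<rho>) n \<in> \<D>" "\<And>z. z \<in> \<D> \<Longrightarrow> z \<in> U \<Longrightarrow> g (\<phi> z) = h z"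
      using \<zeta>(1) h(2,4) x(1) g(2) by auto
    from analytic_extension_by_local_inverse[OF assms(1) open_ball convex_ball X_hol[OF g(1)] open_ball
        w(1,3) h(3,1) this(1,3,2) \<zeta>(3) lim]
    obtain r \<Phi> where \<Phi>: "r > 0" "\<Phi> holomorphic_on ball \<zeta> r" "\<Phi> ` ball \<zeta> r \<subseteq> \<D>"
        "\<And>u. u \<in> \<D> \<inter> ball \<zeta> r \<Longrightarrow> \<Phi> u = \<phi> u"
      by metis
    obtain S where S: "sphere 0 1 \<subseteq> closure S" "\<And>\<zeta>. \<zeta> \<in> S \<Longrightarrow> \<exists>f\<in>X. \<not> extends_analytically_near f \<zeta>"
      using assms(7) by blast
    then obtain \<sigma> where \<sigma>: "\<sigma> \<in> S" "\<sigma> \<in> ball \<zeta> r"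
      using \<open>\<zeta> \<in> sphere 0 1\<close> \<Phi>(1) by (metis closure_approachable dist_commute mem_ball subsetD)
    obtain f where f: "f \<in> X" "\<not> extends_analytically_near f \<sigma>" using S(2) \<sigma>(1) by blast
    obtain q where q: "q \<in> X" "\<And>z. z \<in> \<D> \<Longrightarrow> f z = q (\<phi> z)"
      using factor[OF f(1)] by metis
    obtain t where t: "t > 0" "ball \<sigma> t \<subseteq> ball \<zeta> r"
      using \<sigma>(2) open_contains_ball[of "ball \<zeta> r"] open_ball by blast
    \<comment> \<open>\<open>f = q \<circ> \<phi>\<close> extends because the continued \<open>\<phi>\<close> still takes values in \<open>\<D>\<close>, where \<open>q\<close> is analytic.\<close>
    define \<phi>' where "\<phi>' = (\<lambda>z. if z \<in> \<D> then \<phi> z else \<Phi> z)"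
    have "\<phi>' holomorphic_on (\<D> \<union> ball \<sigma> t)"
      unfolding \<phi>'_def
      by (rule holomorphic_on_If_Un)
         (use assms(1) \<Phi>(4) t(2) in \<open>auto intro: holomorphic_on_subset[OF \<Phi>(2)]\<close>)
    moreover have "\<phi>' ` (\<D> \<union> ball \<sigma> t) \<subseteq> \<D>"
      using assms(2) \<Phi>(3) t(2) by (force simp: \<phi>'_def)
    ultimately have "(q \<circ> \<phi>') holomorphic_on (\<D> \<union> ball \<sigma> t)"
      using X_hol[OF q(1)] holomorphic_on_compose_gen by blast
    moreover have "\<And>z. z \<in> \<D> \<Longrightarrow> (q \<circ> \<phi>') z = f z"
      using q(2) by (simp add: \<phi>'_def)
    ultimately have "extends_analytically_near f \<sigma>"
      unfolding extends_analytically_near_def using t(1) by blast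
    then show False using f(2) by blast
  qed
  then show ?thesis
    using assms(1) inj by (simp add: disc_automorphism_def bij_betw_def)
qed

end
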